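(* Let $n\geq 0$. For every word $v\in\{a,b\}^n$ one has $$|\psi(v)|\leq|\psi(v^{(n)})|,$$ and equality holds if and only if $v=v^{(n)}$ or $v=E(v^{(n)})$.
   Context: Let $\mathcal{A}=\{a,b\}$, let $\mathcal{A}^*$ be the free monoid over $\mathcal{A}$ with empty word $\varepsilon$, and let $\mathcal{A}^n$ denote the set of words of length $n$. For a word $w$, $w^{(+)}$ denotes the shortest palindrome having $w$ as a prefix. The palindromization map $\psi:\mathcal{A}^*\to\mathcal{A}^*$ is defined by $\psi(\varepsilon)=\varepsilon$ and $\psi(vx)=(\psi(v)x)^{(+)}$ for $v\in\mathcal{A}^*$, $x\in\mathcal{A}$. For $n\geq 0$, $v^{(n)}$ denotes the prefix of length $n$ of the infinite word $(ab)^\omega=abab\cdots$. $E$ is the automorphism of $\mathcal{A}^*$ with $E(a)=b$, $E(b)=a$. *)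

theory Defs
  imports Main "HOL-Library.Sublist" "HOL-Library.Stream"
begin

datatype letter = La | Lb

type_synonym word = "letter list"

definition palindrome :: "'a list \<Rightarrow> bool" where
  "palindrome w \<longleftrightarrow> rev w = w"

definition is_shortest_pal_ext :: "'a list \<Rightarrow> 'a list \<Rightarrow> bool" where
  "is_shortest_pal_ext w p \<longleftrightarrow>
     palindrome p \<and> prefix w p \<and>
     (\<forall>q. palindrome q \<and> prefix w q \<longrightarrow> length p \<le> length q)"

text \<open>The word $w^{(+)}$. The description is proper by \<open>ex1_shortest_pal_ext\<close> below.\<close>

definition pal_closure :: "'a list \<Rightarrow> 'a list" where
  "pal_closure w = (THE p. is_shortest_pal_ext w p)"

lemma ex1_shortest_pal_ext: "\<exists>!p. is_shortest_pal_ext w p"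
proof -
  let ?P = "\<lambda>p. palindrome p \<and> prefix w p"
  have base: "?P (w @ rev w)"
    by (simp add: palindrome_def)
  obtain p where p: "?P p" "\<And>q. ?P q \<Longrightarrow> length p \<le> length q"
    using ex_has_least_nat[of ?P "w @ rev w" length] base by blast
  have unique: "q = p" if q: "is_shortest_pal_ext w q" for q
  proof (rule nth_equalityI)
    have qP: "?P q" and qmin: "length q \<le> length p"
      using q p(1) by (auto simp: is_shortest_pal_ext_def)
    show len: "length q = length p"
      using qmin p(2)[OF qP] by simp
    have short: "length p \<le> 2 * length w"
      using p(2)[OF base] by simp
    obtain s t where st: "p = w @ s" "q = w @ t"
      using p(1) qP by (auto simp: prefix_def)
    fix i assume i: "i < length q"
    show "q ! i = p ! i"
    proof (cases "i < length w")
      case True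
      then show ?thesis by (simp add: st nth_append)
    next
      case False
      let ?j = "length p - Suc i"
      have j: "?j < length w"
        using False short i len by linarith
      have "q ! i = rev q ! i"
        using qP by (simp add: palindrome_def)
      also have "\<dots> = q ! ?j"
        using i len by (simp add: rev_nth)
      also have "\<dots> = p ! ?j"
        using j by (simp add: st nth_append)
      also have "\<dots> = rev p ! i"
        using i len by (simp add: rev_nth)
      also have "\<dots> = p ! i"
        using p(1) by (simp add: palindrome_def)
      finally show ?thesis .
    qed
  qed
  show ?thesis
  proof (rule ex1I[of _ p])
    show "is_shortest_pal_ext w p"
      using p by (simp add: is_shortest_pal_ext_def)
  qed (rule unique)
qed

lemma pal_closure_shortest: "is_shortest_pal_ext w (pal_closure w)"
  unfolding pal_closure_def by (rule theI'[OF ex1_shortest_pal_ext])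

function psi :: "word \<Rightarrow> word" where
  "psi [] = []"
| "psi (v @ [x]) = pal_closure (psi v @ [x])"
proof -
  fix P :: bool and w :: word
  assume "w = [] \<Longrightarrow> P" and "\<And>v x. w = v @ [x] \<Longrightarrow> P"
  then show P by (cases w rule: rev_cases) auto
qed auto
termination
  by (relation "measure length") auto

text \<open>The prefix of length $n$ of $(ab)^\omega$.\<close>

definition alt_word :: "nat \<Rightarrow> word" where
  "alt_word n = stake n (cycle [La, Lb])"

fun swap_letter :: "letter \<Rightarrow> letter" where
  "swap_letter La = Lb"
| "swap_letter Lb = La"

definition E :: "word \<Rightarrow> word" where
  "E w = map swap_letter w"

end

theory Submission
  imports Defs "HOL-Number_Theory.Fib"
begin

text \<open>The palindromic prefixes of $\psi(v)$ are the words $\psi(u)$ with $u$ a prefix of $v$, so the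
  longest palindromic suffix of $\psi(v)x$ is $x\psi(u)x$ where $ux$ is the longest prefix of $v$
  ending in $x$. Hence the increments $p_x(v) = |\psi(vx)| - |\psi(v)|$ satisfy the additive
  recursion $p_x(vx) = p_x(v)$, $p_y(vx) = p_x(v) + p_y(v)$ for $y \neq x$, with
  $p_a(\varepsilon) = p_b(\varepsilon) = 1$ and $|\psi(v)| + 2 = p_a(v) + p_b(v)$.
  The pair grows fastest when the larger increment is always chosen, that is, along an alternating
  word, and then the values are Fibonacci numbers.\<close>

section \<open>Palindromic closure\<close>

lemma palindrome_Nil [simp]: "palindrome []"
  and palindrome_singleton [simp]: "palindrome [x]"
  by (simp_all add: palindrome_def)

lemma palindrome_pal_closure: "palindrome (pal_closure w)"
  and prefix_pal_closure: "prefix w (pal_closure w)"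
  and length_pal_closure_le:
    "palindrome q \<Longrightarrow> prefix w q \<Longrightarrow> length (pal_closure w) \<le> length q"
  using pal_closure_shortest[of w] by (auto simp: is_shortest_pal_ext_def)

text \<open>Folding \<open>w = s @ t\<close> around \<open>t\<close> gives the palindrome
  \<open>s @ t @ rev s\<close>. Conversely, an extension \<open>w @ r\<close> that is at most this
  long exhibits a palindromic suffix of \<open>w\<close> of length
  \<open>length w - length r\<close>.\<close>

lemma length_pal_closure:
  assumes t: "suffix t w" "palindrome t"
    and longest: "\<And>t'. suffix t' w \<Longrightarrow> palindrome t' \<Longrightarrow> length t' \<le> length t"
  shows "length (pal_closure w) + length t = 2 * length w"
proof -
  obtain s where w: "w = s @ t"
    using t(1) by (auto simp: suffix_def)
  have "palindrome (s @ t @ rev s)" "prefix w (s @ t @ rev s)"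
    using t(2) w by (simp_all add: palindrome_def)
  then have le: "length (pal_closure w) \<le> length (s @ t @ rev s)"
    by (rule length_pal_closure_le)
  obtain r where r: "pal_closure w = w @ r"
    using prefix_pal_closure by (auto simp: prefix_def)
  have "length r \<le> length w"
    using le[unfolded r] w by simp
  moreover have pal: "rev r @ rev w = w @ r"
    using palindrome_pal_closure[of w] by (simp add: r palindrome_def)
  \<comment> \<open>\<open>rev r\<close> and \<open>w\<close> are prefixes of the same word, and
    \<open>r\<close> is no longer than \<open>w\<close>.\<close>
  ultimately obtain t' where t': "w = rev r @ t'"
    by (metis append_eq_append_conv_if length_rev append_take_drop_id)
  have "palindrome t'"
    using pal unfolding palindrome_def t' by simp
  then have "length t' \<le> length t"
    using longest t' by (auto simp: suffix_def)
  moreover have "length w = length r + length t'"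
    by (simp add: t')
  ultimately show ?thesis
    using le r w by simp
qed

section \<open>Palindromic prefixes of a palindromization\<close>

lemma palindrome_psi: "palindrome (psi v)"
  by (cases v rule: rev_cases) (simp_all add: palindrome_pal_closure)

lemma prefix_psi_snoc: "prefix (psi v @ [x]) (psi (v @ [x]))"
  by (simp add: prefix_pal_closure)

lemma length_psi_snoc: "length (psi v) < length (psi (v @ [x]))"
  using prefix_length_le[OF prefix_psi_snoc[of v x]] by simp

lemma prefix_psi_append: "prefix (psi u) (psi (u @ t))"
proof (induction t rule: rev_induct)
  case (snoc x t)
  then show ?case
    using prefix_psi_snoc[of "u @ t" x] by (metis append_assoc prefixI prefix_order.trans)
qed simp

lemma prefix_psi_append_Cons: "prefix (psi u @ [z]) (psi (u @ z # t))"
  using prefix_psi_append[of "u @ [z]" t] prefix_psi_snoc[of u z]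
  by (metis append.assoc append_Cons append_Nil prefix_order.trans)

text \<open>A palindromic prefix of \<open>psi (v @ [x])\<close> longer than \<open>psi v\<close>
  extends \<open>psi v @ [x]\<close>, so minimality of the closure forces it to be the whole
  word.\<close>

lemma palindromic_prefix_of_psi:
  assumes "palindrome q" "prefix q (psi v)"
  obtains u where "prefix u v" "q = psi u"
  using assms(2)
proof (induction v arbitrary: thesis rule: rev_induct)
  case Nil
  then show ?case by simp
next
  case (snoc x v)
  show ?case
  proof (cases "length q \<le> length (psi v)")
    case True
    then have "prefix q (psi v)"
      using snoc.prems(2) prefix_psi_snoc[of v x]
      by (metis append_prefixD prefix_length_prefix)
    then show ?thesis
      using snoc.IH snoc.prems(1) by (metis prefix_append prefix_snoc)
  next
    case False
    then have "prefix (psi v @ [x]) q"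
      using prefix_length_prefix[OF prefix_psi_snoc[of v x] snoc.prems(2)] by simp
    then have "length (psi (v @ [x])) \<le> length q"
      using length_pal_closure_le[OF assms(1)] by simp
    then have "q = psi (v @ [x])"
      using snoc.prems(2) by (metis prefix_length_le le_antisym not_equal_is_parallel
          parallel_def prefix_order.refl)
    then show ?thesis
      using snoc.prems(1) by blast
  qed
qed

text \<open>Write \<open>q = x # m @ [x]\<close>. Since \<open>psi v\<close> is a palindrome, its
  suffix \<open>x # m\<close> reverses to a prefix \<open>m @ [x]\<close>; hence \<open>m\<close> is
  some \<open>psi u\<close>, and the letter of \<open>v\<close> after \<open>u\<close> is the one
  following \<open>psi u\<close> in \<open>psi v\<close>.\<close>

lemma palindromic_suffix_of_psi_snoc:
  assumes "palindrome q" "suffix q (psi v @ [x])"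
  shows "length q \<le> 1 \<or> (\<exists>u t. v = u @ x # t \<and> q = x # psi u @ [x])"
proof (cases "length q \<le> 1")
  case False
  obtain q1 where q1: "q = q1 @ [x]" "suffix q1 (psi v)"
    using assms(2) False by (auto simp: suffix_snoc)
  obtain y m where ym: "q1 = y # m"
    using False q1(1) by (cases q1) auto
  have "x = hd (rev q)"
    unfolding q1(1) by simp
  also have "\<dots> = y"
    using assms(1) unfolding palindrome_def q1(1) ym by (metis append_Cons list.sel(1))
  finally have m: "q = x # m @ [x]"
    unfolding q1(1) ym by simp
  then have pal: "palindrome m"
    using assms(1) unfolding m palindrome_def by simp
  have suf: "suffix (x # m) (psi v)"
    using q1 m by simp
  then have pre: "prefix (m @ [x]) (psi v)"
    using pal palindrome_psi[of v] by (simp add: suffix_to_prefix palindrome_def)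
  then obtain u where u: "prefix u v" "m = psi u"
    using palindromic_prefix_of_psi[OF pal] append_prefixD by blast
  have "u \<noteq> v"
    using prefix_length_le[OF pre] u(2) by auto
  then obtain z t where v: "v = u @ z # t"
    using u(1) by (metis append.right_neutral prefix_def neq_Nil_conv)
  have "prefix (psi u @ [z]) (psi v)"
    unfolding v by (rule prefix_psi_append_Cons)
  with pre u(2) have "z = x"
    by (auto simp: prefix_def)
  then show ?thesis
    using v m u(2) by blast
qed simp

lemma length_psi_snoc_new:
  assumes "x \<notin> set v"
  shows "length (psi (v @ [x])) = 2 * length (psi v) + 1"
proof -
  have "length (pal_closure (psi v @ [x])) + length [x] = 2 * length (psi v @ [x])"
  proof (rule length_pal_closure)
    show "suffix [x] (psi v @ [x])"
      by (simp add: suffix_def)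
  qed (use assms palindromic_suffix_of_psi_snoc in fastforce)+
  then show ?thesis by simp
qed

lemma length_psi_mono: "length (psi u) \<le> length (psi (u @ t))"
  by (rule prefix_length_le[OF prefix_psi_append])

text \<open>The last occurrence of \<open>x\<close> in \<open>v\<close> gives the longest
  \<open>psi u\<close>, so \<open>x # psi u @ [x]\<close> is the longest palindromic suffix to fold
  around.\<close>

lemma length_psi_snoc_old:
  assumes "x \<notin> set t" and v: "v = u @ x # t"
  shows "length (psi (v @ [x])) + length (psi u) = 2 * length (psi v)"
proof -
  let ?t = "x # psi u @ [x]"
  have "length (pal_closure (psi v @ [x])) + length ?t = 2 * length (psi v @ [x])"
  proof (rule length_pal_closure)
    have "prefix (psi u @ [x]) (psi v)"
      unfolding v by (rule prefix_psi_append_Cons)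
    then have "suffix (x # psi u) (psi v)"
      using palindrome_psi[of u] palindrome_psi[of v]
      by (simp add: suffix_to_prefix palindrome_def)
    then show "suffix ?t (psi v @ [x])"
      by (auto simp: suffix_def)
    show "palindrome ?t"
      using palindrome_psi[of u] by (simp add: palindrome_def)
  next
    fix q
    assume "suffix q (psi v @ [x])" "palindrome q"
    then consider "length q \<le> 1"
      | u' t' where "v = u' @ x # t'" "q = x # psi u' @ [x]"
      using palindromic_suffix_of_psi_snoc by blast
    then show "length q \<le> length ?t"
    proof cases
      case 2
      \<comment> \<open>No \<open>x\<close> lies in \<open>t\<close>, so the occurrence after
        \<open>u'\<close> is not later than the one after \<open>u\<close>.\<close>
      then obtain s where "u = u' @ s"
        using assms by (auto simp: append_eq_append_conv2 append_eq_Cons_conv Cons_eq_append_conv)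
      then show ?thesis
        using 2 length_psi_mono by simp
    qed simp
  qed
  then show ?thesis by simp
qed

section \<open>Increments of the length\<close>

definition inc :: "letter \<Rightarrow> word \<Rightarrow> nat" where
  "inc x v = length (psi (v @ [x])) - length (psi v)"

lemma length_psi_inc: "length (psi (v @ [x])) = length (psi v) + inc x v"
  using length_psi_snoc[of v x] by (simp add: inc_def)

lemma inc_Nil [simp]: "inc x [] = 1"
  using length_psi_snoc_new[of x "[]"] by (simp add: inc_def)

text \<open>The last \<open>x\<close> of \<open>v @ [x]\<close> is preceded by \<open>v\<close>
  itself, so the lengths for \<open>v\<close>, \<open>vx\<close>, \<open>vxx\<close> form an
  arithmetic progression.\<close>

lemma inc_snoc_same: "inc x (v @ [x]) = inc x v"
  using length_psi_snoc_old[of x "[]" "v @ [x]" v] length_psi_inc[of v x]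
    length_psi_inc[of "v @ [x]" x] by simp

text \<open>Appending \<open>x\<close> leaves the last occurrence of \<open>y\<close>, or its
  absence, unchanged; the two length formulas thus share their constant term, which cancels.\<close>

lemma inc_snoc_other:
  assumes "y \<noteq> x"
  shows "inc y (v @ [x]) = inc x v + inc y v"
proof (cases "y \<in> set v")
  case True
  then obtain u t where v: "v = u @ y # t" "y \<notin> set t"
    by (metis split_list_last)
  then have "length (psi (v @ [y])) + length (psi u) = 2 * length (psi v)"
    "length (psi ((v @ [x]) @ [y])) + length (psi u) = 2 * length (psi (v @ [x]))"
    using assms by (intro length_psi_snoc_old[of y "t @ [x]"] length_psi_snoc_old[of y t]; simp)+
  then show ?thesis
    unfolding length_psi_inc by simp
next
  case False
  then have "length (psi (v @ [y])) = 2 * length (psi v) + 1"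
    "length (psi ((v @ [x]) @ [y])) = 2 * length (psi (v @ [x])) + 1"
    using assms by (intro length_psi_snoc_new; simp)+
  then show ?thesis
    unfolding length_psi_inc by simp
qed

lemma swap_letter_swap_letter [simp]: "swap_letter (swap_letter x) = x"
  by (cases x) simp_all

lemma swap_letter_neq [simp]: "swap_letter x \<noteq> x" "x \<noteq> swap_letter x"
  by (cases x; simp)+

lemma eq_or_eq_swap_letter: "y = x \<or> y = swap_letter x"
  by (cases x; cases y) simp_all

lemma inc_swap_letter_snoc: "inc (swap_letter x) (v @ [x]) = inc x v + inc (swap_letter x) v"
  by (simp add: inc_snoc_other)

text \<open>Appending \<open>y\<close> raises both sides by \<open>inc y v\<close>. The right side
  is symmetric in the two letters, so \<open>x\<close> may be taken to be the last letter.\<close>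

lemma length_psi_eq_inc: "length (psi v) + 2 = inc x v + inc (swap_letter x) v"
proof (induction v arbitrary: x rule: rev_induct)
  case (snoc y v)
  have "length (psi (v @ [y])) + 2 = inc y (v @ [y]) + inc (swap_letter y) (v @ [y])"
    using snoc[of y] by (simp only: length_psi_inc inc_snoc_same inc_swap_letter_snoc)
  then show ?case
    using eq_or_eq_swap_letter[of x y] by auto
qed simp

text \<open>The recursion for the increments treats the two letters alike.\<close>

lemma inc_E: "inc (swap_letter x) (E v) = inc x v"
proof (induction v arbitrary: x rule: rev_induct)
  case (snoc y v)
  have E: "E (v @ [y]) = E v @ [swap_letter y]"
    by (simp add: E_def)
  show ?case
  proof (cases "x = y")
    case True
    then show ?thesis
      using snoc[of y] by (simp add: E inc_snoc_same)
  next
    case False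
    then show ?thesis
      using snoc[of y] snoc[of x]
      by (metis E inc_snoc_other swap_letter_swap_letter)
  qed
qed (simp add: E_def)

lemma length_psi_E: "length (psi (E v)) = length (psi v)"
  using length_psi_eq_inc[of v La] length_psi_eq_inc[of "E v" Lb] inc_E[of La v] inc_E[of Lb v]
  by simp

section \<open>The alternating word\<close>

definition alt_letter :: "nat \<Rightarrow> letter" where
  "alt_letter n = (if even n then La else Lb)"

lemma alt_letter_Suc: "alt_letter (Suc n) = swap_letter (alt_letter n)"
  by (simp add: alt_letter_def)

lemma snth_cycle_La_Lb: "cycle [La, Lb] !! n = alt_letter n"
proof (induction n rule: less_induct)
  case (less n)
  have cyc: "cycle [La, Lb] = La ## Lb ## cycle [La, Lb]"
    by (metis append_Cons append_Nil cycle_decomp list.distinct(1) shift.simps)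
  show ?case
  proof (cases "n < 2")
    case True
    then show ?thesis
      by (subst cyc) (auto simp: less_2_cases_iff alt_letter_def)
  next
    case False
    then obtain m where m: "n = Suc (Suc m)"
      by (metis add_2_eq_Suc le_Suc_ex not_less)
    then show ?thesis
      using less[of m] by (subst cyc) (simp add: alt_letter_def)
  qed
qed

lemma alt_word_0 [simp]: "alt_word 0 = []"
  by (simp add: alt_word_def)

lemma alt_word_Suc: "alt_word (Suc n) = alt_word n @ [alt_letter n]"
  by (simp only: alt_word_def stake_Suc snth_cycle_La_Lb)

lemma E_alt_word_Suc: "E (alt_word (Suc n)) = E (alt_word n) @ [swap_letter (alt_letter n)]"
  by (simp add: alt_word_Suc E_def)

text \<open>The next letter of the alternating word always carries the larger increment, which turns
  the recursion into the Fibonacci one.\<close>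

lemma inc_alt_word:
  "inc (alt_letter n) (alt_word n) = fib (Suc (Suc n)) \<and>
   inc (swap_letter (alt_letter n)) (alt_word n) = fib (Suc n)"
  by (induction n)
    (simp_all add: alt_letter_Suc alt_word_Suc inc_snoc_same inc_swap_letter_snoc)

lemma length_psi_alt_word: "length (psi (alt_word n)) + 2 = fib (n + 3)"
  using length_psi_eq_inc[of "alt_word n" "alt_letter n"] inc_alt_word[of n]
  by (simp add: numeral_eq_Suc)

section \<open>The extremal words\<close>

text \<open>The bounds feed each other: the length grows by an increment, and the new larger
  increment is the old length plus 2.\<close>

lemma inc_le_fib: "inc x v \<le> fib (length v + 2)"
  and length_psi_le_fib: "length (psi v) + 2 \<le> fib (length v + 3)"
proof -
  have "(\<forall>x. inc x v \<le> fib (length v + 2)) \<and> length (psi v) + 2 \<le> fib (length v + 3)"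
  proof (induction v rule: rev_induct)
    case (snoc y v)
    then have le: "inc y v \<le> fib (length v + 2)" "length (psi v) + 2 \<le> fib (length v + 3)"
      by auto
    have "inc y (v @ [y]) \<le> fib (length v + 3)"
      using le(1) fib_mono[of "length v + 2" "length v + 3"] by (simp add: inc_snoc_same)
    moreover have "inc (swap_letter y) (v @ [y]) \<le> fib (length v + 3)"
      using le(2) length_psi_eq_inc[of v y] by (simp add: inc_swap_letter_snoc)
    ultimately have "inc x (v @ [y]) \<le> fib (length v + 3)" for x
      using eq_or_eq_swap_letter[of x y] by auto
    moreover have "length (psi (v @ [y])) + 2 \<le> fib (length v + 4)"
      using le by (simp add: length_psi_inc numeral_eq_Suc del: psi.simps)
    ultimately show ?case
      by (simp add: numeral_eq_Suc del: psi.simps)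
  qed (simp add: numeral_eq_Suc)
  then show "inc x v \<le> fib (length v + 2)" "length (psi v) + 2 \<le> fib (length v + 3)"
    by auto
qed

text \<open>The increments are consecutive Fibonacci numbers, distinct once \<open>n > 0\<close>; at
  \<open>n = 0\<close> both are 1.\<close>

lemma inc_alt_word_eq_fib:
  assumes "inc x (alt_word n) = fib (n + 2)" "n > 0"
  shows "x = alt_letter n"
proof (rule ccontr)
  assume "x \<noteq> alt_letter n"
  then have "fib (n + 2) = fib (n + 1)"
    using assms(1) inc_alt_word[of n] eq_or_eq_swap_letter[of x "alt_letter n"] by simp
  then show False
    using fib_neq_0_nat[OF assms(2)] by (simp add: numeral_eq_Suc)
qed

lemma length_psi_eq_fib_imp:
  assumes "length (psi v) + 2 = fib (length v + 3)"
  shows "v = alt_word (length v) \<or> v = E (alt_word (length v))"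
  using assms
proof (induction v rule: rev_induct)
  case (snoc x v)
  let ?n = "length v"
  have "(length (psi v) + 2) + inc x v = fib (?n + 3) + fib (?n + 2)"
    using snoc.prems by (simp add: length_psi_inc numeral_eq_Suc del: psi.simps)
  \<comment> \<open>Equality in the sum of two upper bounds forces equality in each.\<close>
  then have max: "length (psi v) + 2 = fib (?n + 3)" "inc x v = fib (?n + 2)"
    using inc_le_fib[of x v] length_psi_le_fib[of v] by linarith+
  show ?case
  \<comment> \<open>The first letter is free, which accounts for the two extremal words; every later
    letter is forced.\<close>
  proof (cases "?n = 0")
    case True
    then show ?thesis
      by (cases x) (simp_all add: alt_word_Suc E_def alt_letter_def)
  next
    case False
    from snoc.IH[OF max(1)] show ?thesis
    proof
      assume "v = alt_word ?n"
      then have "x = alt_letter ?n"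
        using inc_alt_word_eq_fib max(2) False by (metis gr0I)
      then show ?thesis
        using \<open>v = alt_word ?n\<close> by (simp add: alt_word_Suc)
    next
      assume v: "v = E (alt_word ?n)"
      then have "inc (swap_letter x) (alt_word ?n) = fib (?n + 2)"
        using max(2) inc_E[of "swap_letter x" "alt_word ?n"] by simp
      then have "x = swap_letter (alt_letter ?n)"
        using inc_alt_word_eq_fib False by (metis gr0I swap_letter_swap_letter)
      then show ?thesis
        using v by (simp add: E_alt_word_Suc)
    qed
  qed
qed (simp add: alt_word_def)

theorem theorem4p1:
  fixes n :: nat and v :: word
  assumes "length v = n"
  shows "length (psi v) \<le> length (psi (alt_word n)) \<and>
         (length (psi v) = length (psi (alt_word n)) \<longleftrightarrow>
            v = alt_word n \<or> v = E (alt_word n))"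
  using length_psi_alt_word[of n] length_psi_le_fib[of v, unfolded assms]
    length_psi_eq_fib_imp[of v, unfolded assms] length_psi_E[of "alt_word n"]
  by (metis add_le_cancel_right add_right_cancel)

end
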